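(* Let $\mathbb{R}_+$ denote the positive reals and define $$\mathfrak{R}_1=\{(a,b,c)\in\mathbb{R}_+^3:\ c\ge a+b-1,\ (1+a+b-ab)c\ge 2ab,\ (c-a)(c-b)\ge0\},$$ $$\mathfrak{R}_2=\{(a,b,c)\in\mathbb{R}_+^3:\ c\ge a+b-1,\ (c-a)(c-b)\le0\}.$$ For $s\in\mathbb{R}$ let $\mathcal{F}_s(x)=(1-x)^sF(a,b;c;x)$ on $(0,1)$ and let $w_n(s)$ denote the Maclaurin coefficients of $\ln\mathcal{F}_s$, i.e. $\ln\mathcal{F}_s(x)=\sum_{n=1}^\infty w_n(s)x^n$. Let $C_n$ denote the Maclaurin coefficients of $\ln F(a,b;c;x)$, i.e. $\ln F(a,b;c;x)=\sum_{n=1}^\infty C_nx^n$. Consider the double inequality $$\text{(E)}\quad\frac{\exp\left(\sum_{j=1}^nw_j(p)x^j\right)}{(1-x)^p}<F(a,b;c;x)<\frac{\exp\left(\sum_{j=1}^nw_j(q)x^j\right)}{(1-x)^q}.$$ For $(a,b,c)\in\mathfrak{R}_1$: - if $p\le\max\{0,a+b-c\}$ and $q\ge\frac{ab}{c}$, then (E) holds for all $x\in(0,1)$ and $n\ge1$; - in particular, if $p\le\max\{0,a+b-c\}$ and $q\ge kC_k$ for some $k\ge1$, then (E) holds for all $x\in(0,1)$ and $n\ge k$. For $(a,b,c)\in\mathfrak{R}_2$: - if $p\le\frac{ab}{c}$ and $q\ge a+b-c$, then (E) holds for all $x\in(0,1)$ and $n\ge1$; - in particular, if $p\le kC_k$ and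 $q\ge a+b-c$ for some $k\ge1$, then (E) holds for all $x\in(0,1)$ and $n\ge k$.
   Context: $F(a,b;c;x)=\sum_{n=0}^\infty\frac{(a)_n(b)_n}{(c)_n}\frac{x^n}{n!}$ is the Gaussian hypergeometric function, with $(a)_0=1$ and $(a)_n=a(a+1)\cdots(a+n-1)$ for $n\ge1$. Here $p,q$ are real numbers and $n,k$ are positive integers.
   Formalization: When c=a or c=b, the values p=ab/c and q=ab/c are excluded, since then F(a,b;c;x)=(1-x)^{-ab/c} and the corresponding side of (E) is an equality, so the strict inequality as stated is false (e.g. a=c=1, b=p=1/2). *)

theory Defs
  imports "HOL-Analysis.Analysis"
begin

definition gauss_hypergeo :: "real \<Rightarrow> real \<Rightarrow> real \<Rightarrow> real \<Rightarrow> real" where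
  "gauss_hypergeo a b c x =
     (\<Sum>n. pochhammer a n * pochhammer b n / pochhammer c n * (x ^ n / fact n))"

definition maclaurin_coeff :: "(real \<Rightarrow> real) \<Rightarrow> nat \<Rightarrow> real" where
  "maclaurin_coeff f n = (deriv ^^ n) f 0 / fact n"

(* The formula also makes sense for x in (-1, 0], which is what gives meaning to the
   (two-sided) derivatives at 0 of ln o hyp_F s used below. *)
definition hyp_F :: "real \<Rightarrow> real \<Rightarrow> real \<Rightarrow> real \<Rightarrow> real \<Rightarrow> real" where
  "hyp_F a b c s x = (1 - x) powr s * gauss_hypergeo a b c x"

definition w_coeff :: "real \<Rightarrow> real \<Rightarrow> real \<Rightarrow> real \<Rightarrow> nat \<Rightarrow> real" where
  "w_coeff a b c s n = maclaurin_coeff (\<lambda>x. ln (hyp_F a b c s x)) n"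

definition C_coeff :: "real \<Rightarrow> real \<Rightarrow> real \<Rightarrow> nat \<Rightarrow> real" where
  "C_coeff a b c n = maclaurin_coeff (\<lambda>x. ln (gauss_hypergeo a b c x)) n"

definition region1 :: "(real \<times> real \<times> real) set" where
  "region1 = {(a, b, c). a > 0 \<and> b > 0 \<and> c > 0 \<and>
     c \<ge> a + b - 1 \<and> (1 + a + b - a * b) * c \<ge> 2 * a * b \<and> (c - a) * (c - b) \<ge> 0}"

definition region2 :: "(real \<times> real \<times> real) set" where
  "region2 = {(a, b, c). a > 0 \<and> b > 0 \<and> c > 0 \<and>
     c \<ge> a + b - 1 \<and> (c - a) * (c - b) \<le> 0}"

definition exp_bound :: "real \<Rightarrow> real \<Rightarrow> real \<Rightarrow> real \<Rightarrow> nat \<Rightarrow> real \<Rightarrow> real" where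
  "exp_bound a b c s n x = exp (\<Sum>j=1..n. w_coeff a b c s j * x ^ j) / (1 - x) powr s"

definition double_ineq ::
    "real \<Rightarrow> real \<Rightarrow> real \<Rightarrow> real \<Rightarrow> real \<Rightarrow> nat \<Rightarrow> real \<Rightarrow> bool" where
  "double_ineq a b c p q n x \<longleftrightarrow>
     exp_bound a b c p n x < gauss_hypergeo a b c x \<and>
     gauss_hypergeo a b c x < exp_bound a b c q n x"

end

theory Submission
  imports Defs
begin

text \<open>
  Write \<open>u = F'/F\<close> for the logarithmic derivative of \<open>F = F(a,b;c;\<cdot>)\<close>. Since
  \<open>ln F\<close> is the integral of \<open>u\<close> and \<open>ln (1 - x) = - (\<Sum>j\<ge>1. x ^ j / j)\<close>, the coefficients are
  \<open>w_j(s) = (u_(j-1) - s) / j\<close> and \<open>C_j = u_(j-1) / j\<close>. Dividing by \<open>F\<close> and taking logarithms, each side of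
  the double inequality says that the tail \<open>\<Sum>j>n. w_j(s) x ^ j\<close> has a definite sign, which is
  clear once every \<open>u_j\<close> with \<open>j \<ge> n\<close> lies strictly between \<open>p\<close> and \<open>q\<close>. So everything
  reduces to the monotonicity of the sequence \<open>u_n\<close>, which starts at \<open>u_0 = ab/c\<close>, and to a bound on
  its limit.

  The differences \<open>u_n - u_(n-1)\<close> are the coefficients of \<open>g = (1 - x) u\<close>. The hypergeometric
  equation turns into a Riccati equation for \<open>g\<close> whose power series solution is unique
  (\<open>riccati_hyp\<close>, \<open>riccati_unique\<close>). Adding the constant \<open>s = a + b - c\<close> carries solutions for the
  parameters \<open>(c-a, c-b, c)\<close> to solutions for \<open>(a, b, c)\<close>; this is the logarithmic derivative of Euler's
  transformation \<open>F(a,b;c;x) = (1-x)^(-s) H(x)\<close> with \<open>H = F(c-a,c-b;c;\<cdot>)\<close>, and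
  it gives \<open>u_n = v_n + s\<close> with \<open>v = H'/H\<close> (\<open>euler_log_deriv_nth\<close>). The condition
  \<open>c \<ge> a + b - 1\<close> controls the signs in \<open>H\<close>: both \<open>c - a\<close> and \<open>c - b\<close> exceed \<open>-1\<close>, so
  all nonconstant coefficients of \<open>H\<close> have the sign of \<open>(c - a)(c - b)\<close> (\<open>hyp_nth_sign\<close>).

  If \<open>(c - a)(c - b) > 0\<close>, the recurrence read off from the Riccati equation makes all \<open>g_n\<close> with
  \<open>n \<ge> 1\<close> negative by induction, so \<open>u_n\<close> and \<open>v_n\<close> decrease. A decreasing sequence of coefficients
  of a logarithmic derivative \<open>f'/f\<close> cannot become negative if \<open>f\<close> has nonnegative coefficients and
  converges on the unit disc (\<open>antimono_log_deriv_nonneg\<close>); applied to \<open>F\<close> and to \<open>H\<close> this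
  gives \<open>u_n \<ge> max 0 s\<close>.

  If \<open>(c - a)(c - b) < 0\<close>, then \<open>H\<close> is \<open>1\<close> minus a series with nonnegative coefficients, so \<open>1/H\<close> has
  nonnegative coefficients. Both \<open>-v = -H'/H\<close> and \<open>g - g_0\<close> are then products of \<open>1/H\<close> with series
  having nonnegative coefficients, so \<open>u_n\<close> increases and \<open>u_n \<le> s\<close>.

  If \<open>(c - a)(c - b) = 0\<close>, then \<open>H = 1\<close>, the sequence \<open>u_n\<close> is constant, and strictness
  comes from the hypothesis that \<open>p\<close> and \<open>q\<close> avoid its value.
\<close>

unbundle no vec_syntax
unbundle fps_syntax

section \<open>The hypergeometric series and the Riccati equation\<close>

definition hyp :: "real \<Rightarrow> real \<Rightarrow> real \<Rightarrow> real fps" where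
  "hyp a b c = fps_hypergeo [a, b] [c] 1"

lemma hyp_nth:
  "hyp a b c $ n = pochhammer a n * pochhammer b n / (pochhammer c n * fact n)"
  by (simp add: hyp_def)

lemma hyp_nth_0 [simp]: "hyp a b c $ 0 = 1"
  by (simp add: hyp_nth)

lemma hyp_nth_Suc:
  assumes "c > 0"
  shows "(real n + 1) * (real n + c) * hyp a b c $ Suc n = (real n + a) * (real n + b) * hyp a b c $ n"
proof -
  have "pochhammer c n > 0" using assms by (rule pochhammer_pos)
  moreover have "real n + c \<noteq> 0" using assms by (simp add: add_nonneg_eq_0_iff)
  ultimately show ?thesis
    by (simp add: hyp_nth pochhammer_Suc divide_simps) (simp add: algebra_simps)
qed

lemma hyp_ode:
  assumes "c > 0"
  shows "fps_X * (1 - fps_X) * fps_deriv (fps_deriv (hyp a b c))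
         + (fps_const c - fps_const (a + b + 1) * fps_X) * fps_deriv (hyp a b c)
         = fps_const (a * b) * hyp a b c"
proof (rule fps_ext)
  fix n
  show "(fps_X * (1 - fps_X) * fps_deriv (fps_deriv (hyp a b c))
         + (fps_const c - fps_const (a + b + 1) * fps_X) * fps_deriv (hyp a b c)) $ n
         = (fps_const (a * b) * hyp a b c) $ n"
    using hyp_nth_Suc[OF assms, of n a b]
    by (cases n; cases "n - 1") (simp_all add: algebra_simps)
qed

definition log_deriv :: "real fps \<Rightarrow> real fps" where
  "log_deriv f = fps_deriv f * inverse f"

lemma log_deriv_mult:
  assumes "f $ 0 \<noteq> 0"
  shows "log_deriv f * f = fps_deriv f"
  using inverse_mult_eq_1[OF assms] by (simp add: log_deriv_def mult.assoc)

lemma log_deriv_hyp_0: "c > 0 \<Longrightarrow> log_deriv (hyp a b c) $ 0 = a * b / c"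
  using hyp_nth_Suc[of c 0 a b] by (simp add: log_deriv_def field_simps)

text \<open>
  The equation is that of \<open>g = (1 - x) F' / F\<close>. Its factor \<open>1 - x\<close> is chosen so that the coefficients of
  \<open>g\<close> are the increments of those of \<open>F' / F\<close>.
\<close>

definition riccati :: "real \<Rightarrow> real \<Rightarrow> real \<Rightarrow> real fps \<Rightarrow> bool" where
  "riccati a b c g \<longleftrightarrow>
     fps_X * ((1 - fps_X) * fps_deriv g + g * g - fps_const (a + b) * g) + fps_const c * g
     = fps_const (a * b) * (1 - fps_X)"

text \<open>
  Multiplied by \<open>F\<close>, the Riccati equation becomes \<open>1 - x\<close> times the hypergeometric equation, because
  \<open>g F = (1 - x) F'\<close> removes every \<open>g\<close>. The factor \<open>F\<close> cancels in the integral domain of formal power series.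
\<close>

lemma riccati_hyp:
  assumes "c > 0"
  shows "riccati a b c ((1 - fps_X) * log_deriv (hyp a b c))"
proof -
  let ?F = "hyp a b c" and ?X = "fps_X :: real fps"
  define g where "g = (1 - ?X) * log_deriv ?F"
  define ka kb kc where "ka = fps_const a" and "kb = fps_const b" and "kc = fps_const c"
  have F0: "?F \<noteq> 0" using hyp_nth_0[of a b c] by force
  have gF: "g * ?F = (1 - ?X) * fps_deriv ?F"
    by (simp add: g_def mult.assoc log_deriv_mult)
  then have "fps_deriv (g * ?F) = fps_deriv ((1 - ?X) * fps_deriv ?F)" by simp
  then have gF': "fps_deriv g * ?F + g * fps_deriv ?F = (1 - ?X) * fps_deriv (fps_deriv ?F) - fps_deriv ?F"
    by (simp add: algebra_simps)
  have ode: "?X * (1 - ?X) * fps_deriv (fps_deriv ?F) + (kc - (ka + kb + 1) * ?X) * fps_deriv ?F = ka * kb * ?F"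
    using hyp_ode[OF assms, of a b]
    by (simp add: ka_def kb_def kc_def fps_const_add [symmetric] fps_const_mult [symmetric]
       del: fps_const_add fps_const_mult)
  have "(?X * ((1 - ?X) * fps_deriv g + g * g - (ka + kb) * g) + kc * g - ka * kb * (1 - ?X)) * ?F = 0"
    using gF gF' ode by algebra
  then have "?X * ((1 - ?X) * fps_deriv g + g * g - (ka + kb) * g) + kc * g = ka * kb * (1 - ?X)"
    using F0 by simp
  then show ?thesis
    by (simp add: riccati_def g_def ka_def kb_def kc_def)
qed

lemma riccati_nth_0: "riccati a b c g \<Longrightarrow> c * g $ 0 = a * b"
  by (drule arg_cong[of _ _ "\<lambda>f. f $ 0", OF iffD1[OF riccati_def]]) simp

lemma riccati_nth_Suc:
  assumes "riccati a b c g"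
  shows "(real n + 1 + c) * g $ Suc n =
         (real n + a + b) * g $ n - (g * g) $ n - (if n = 0 then a * b else 0)"
proof -
  from assms have "(fps_X * ((1 - fps_X) * fps_deriv g + g * g - fps_const (a + b) * g) + fps_const c * g) $ Suc n
     = (fps_const (a * b) * (1 - fps_X)) $ Suc n"
    by (simp add: riccati_def)
  then show ?thesis by (cases n) (simp_all add: algebra_simps)
qed

text \<open>
  The linear term \<open>c g\<close> contributes \<open>c > 0\<close> to the factor of the highest coefficient in each equation, so
  the coefficients are determined one after the other.
\<close>

lemma riccati_unique:
  assumes "c > 0" and g: "riccati a b c g" and h: "riccati a b c h"
  shows "g = h"
proof (rule fps_ext)
  fix n
  show "g $ n = h $ n"
  proof (induction n rule: less_induct)
    case (less n)
    show ?case
    proof (cases n)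
      case 0
      have "c * g $ 0 = c * h $ 0" using riccati_nth_0[OF g] riccati_nth_0[OF h] by simp
      then show ?thesis using 0 assms(1) by simp
    next
      case (Suc m)
      have "(g * g) $ m = (h * h) $ m"
        using less Suc by (simp add: fps_mult_nth)
      then have "(real m + 1 + c) * g $ n = (real m + 1 + c) * h $ n"
        using riccati_nth_Suc[OF g, of m] riccati_nth_Suc[OF h, of m] less Suc by simp
      moreover have "real m + 1 + c > 0" using assms(1) by linarith
      ultimately show ?thesis by simp
    qed
  qed
qed

text \<open>
  This is Euler's transformation at the level of logarithmic derivatives: multiplying a function by
  \<open>(1 - x) ^ (-s)\<close> adds \<open>s / (1 - x)\<close> to its logarithmic derivative, hence \<open>s\<close> to \<open>g\<close>.
\<close>

lemma riccati_shift:
  assumes "riccati (c - a) (c - b) c g"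
  shows "riccati a b c (g + fps_const (a + b - c))"
proof -
  define ka kb kc X where "ka = fps_const a" and "kb = fps_const b" and "kc = fps_const c"
    and "X = (fps_X :: real fps)"
  have "X * ((1 - X) * fps_deriv g + g * g - ((kc - ka) + (kc - kb)) * g) + kc * g
     = (kc - ka) * (kc - kb) * (1 - X)"
    using assms by (simp add: riccati_def ka_def kb_def kc_def X_def)
  then have "X * ((1 - X) * fps_deriv g + (g + (ka + kb - kc)) * (g + (ka + kb - kc))
       - (ka + kb) * (g + (ka + kb - kc))) + kc * (g + (ka + kb - kc)) = ka * kb * (1 - X)"
    by algebra
  then show ?thesis
    by (simp add: riccati_def ka_def kb_def kc_def X_def)
qed

lemma euler_log_deriv:
  assumes "c > 0"
  shows "(1 - fps_X) * log_deriv (hyp a b c) =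
         (1 - fps_X) * log_deriv (hyp (c - a) (c - b) c) + fps_const (a + b - c)"
  by (rule riccati_unique[OF assms riccati_hyp[OF assms] riccati_shift[OF riccati_hyp[OF assms]]])

lemma euler_log_deriv_nth:
  assumes "c > 0"
  shows "log_deriv (hyp a b c) $ n = log_deriv (hyp (c - a) (c - b) c) $ n + (a + b - c)"
proof (induction n)
  case 0
  from arg_cong[OF euler_log_deriv[OF assms, of a b], of "\<lambda>f. f $ 0"] show ?case by simp
next
  case (Suc n)
  from arg_cong[OF euler_log_deriv[OF assms, of a b], of "\<lambda>f. f $ Suc n"] Suc show ?case by (simp add: algebra_simps)
qed

section \<open>Convergence and signs of the coefficients\<close>

lemma nth_Suc_eq_add_nth_one_minus_X:
  fixes u :: "real fps"
  shows "u $ Suc n = u $ n + ((1 - fps_X) * u) $ Suc n"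
  by (simp add: algebra_simps)

lemma summable_hyp:
  assumes "c > 0" and "\<bar>x\<bar> < 1"
  shows "summable (\<lambda>n. hyp a b c $ n * x ^ n)"
proof -
  define r where "r n = ((real n + a) / (real n + 1)) * ((real n + b) / (real n + c)) * x" for n
  have shift: "(\<lambda>n. (real n + s) / (real n + t)) \<longlonglongrightarrow> 1" if "t > 0" for s t :: real
  proof -
    have "filterlim (\<lambda>n. t + real n) at_top sequentially"
      by (rule filterlim_tendsto_add_at_top[OF tendsto_const filterlim_real_sequentially])
    then have "(\<lambda>n. 1 + (s - t) / (t + real n)) \<longlonglongrightarrow> 1 + 0"
      by (intro tendsto_add tendsto_const tendsto_divide_0[where c = "s - t"] filterlim_at_top_imp_at_infinity)
    moreover have "1 + (s - t) / (t + real n) = (real n + s) / (real n + t)" for n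
      using that by (simp add: field_simps add_nonneg_eq_0_iff)
    ultimately show ?thesis by simp
  qed
  have "r \<longlonglongrightarrow> 1 * 1 * x"
    unfolding r_def by (intro tendsto_intros shift) (use assms in auto)
  then have lim: "(\<lambda>n. \<bar>r n\<bar>) \<longlonglongrightarrow> \<bar>x\<bar>"
    using tendsto_rabs by fastforce
  obtain q where q: "\<bar>x\<bar> < q" "q < 1" using assms(2) dense by blast
  have "\<forall>\<^sub>F n in sequentially. \<bar>r n\<bar> < q"
    using order_tendstoD(2)[OF lim q(1)] .
  then obtain N where N: "\<And>n. n \<ge> N \<Longrightarrow> \<bar>r n\<bar> < q" by (auto simp: eventually_sequentially)
  show ?thesis
  proof (rule summable_ratio_test[OF q(2)])
    fix n assume "n \<ge> N"
    have eq: "hyp a b c $ Suc n * x ^ Suc n = r n * (hyp a b c $ n * x ^ n)"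
    proof -
      have "real n + 1 > 0" "real n + c > 0" using assms(1) by auto
      then have "hyp a b c $ Suc n = (real n + a) / (real n + 1) * ((real n + b) / (real n + c)) * hyp a b c $ n"
        using hyp_nth_Suc[OF assms(1), of n a b] by (simp add: divide_simps) (simp add: mult_ac)
      then show ?thesis by (simp add: r_def)
    qed
    show "norm (hyp a b c $ Suc n * x ^ Suc n) \<le> q * norm (hyp a b c $ n * x ^ n)"
      unfolding eq norm_mult[of "r n"] using N[OF \<open>n \<ge> N\<close>] by (intro mult_right_mono) auto
  qed
qed

lemma conv_radius_hyp: "c > 0 \<Longrightarrow> fps_conv_radius (hyp a b c) \<ge> 1"
  unfolding fps_conv_radius_def one_ereal_def
  by (rule conv_radius_geI_ex') (auto intro: summable_hyp)

text \<open>
  For \<open>a > -1\<close> the only factor of \<open>a (a + 1) \<cdots> (a + n - 1)\<close> that can be negative is the first, and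
  likewise for \<open>b\<close>.
\<close>

lemma hyp_nth_sign:
  assumes "a > -1" "b > -1" "c > 0" and "n \<ge> 1"
  obtains k where "k > 0" and "hyp a b c $ n = a * b * k"
proof -
  obtain m where m: "n = Suc m" using \<open>n \<ge> 1\<close> by (cases n) auto
  let ?k = "pochhammer (a + 1) m * pochhammer (b + 1) m / (pochhammer c n * fact n)"
  have "?k > 0"
    using assms by (intro divide_pos_pos mult_pos_pos pochhammer_pos) auto
  moreover have "hyp a b c $ n = a * b * ?k"
    by (simp add: hyp_nth m pochhammer_rec del: fact_Suc)
  ultimately show ?thesis by (rule that)
qed

section \<open>Logarithmic derivatives of series with coefficients of one sign\<close>

text \<open>
  Suppose \<open>u_N = -\<delta> < 0\<close>, so that \<open>u_n \<le> -\<delta>\<close> for all \<open>n \<ge> N\<close>. In \<open>f' = u f\<close> the coefficients of \<open>f'\<close>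
  are nonnegative, so the negative contributions of the early coefficients of \<open>f\<close> must be
  outweighed by the last \<open>N\<close> of them. This forces the partial sums of the coefficients of \<open>f\<close> to grow by a
  fixed factor \<open>\<rho> > 1\<close> every \<open>N\<close> steps, that is exponentially, which convergence at points close to \<open>1\<close>
  forbids.
\<close>

lemma antimono_log_deriv_nonneg:
  fixes f u :: "real fps"
  assumes f0: "f $ 0 = 1" and f_nonneg: "\<And>n. f $ n \<ge> 0"
    and summ: "\<And>x. 0 < x \<Longrightarrow> x < 1 \<Longrightarrow> summable (\<lambda>n. f $ n * x ^ n)"
    and deriv: "fps_deriv f = u * f"
    and anti: "antimono (fps_nth u)"
  shows "u $ N \<ge> 0"
proof (rule ccontr)
  assume "\<not> u $ N \<ge> 0"
  define \<delta> where "\<delta> = - u $ N"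
  have "\<delta> > 0" using \<open>\<not> u $ N \<ge> 0\<close> by (simp add: \<delta>_def)
  define S where "S n = (\<Sum>i\<le>n. f $ i)" for n
  have S_ge_1: "S n \<ge> 1" for n
  proof -
    have "f $ 0 \<le> S n" unfolding S_def using f_nonneg by (intro member_le_sum) auto
    then show ?thesis by (simp add: f0)
  qed
  have S_mono: "S m \<le> S n" if "m \<le> n" for m n
    unfolding S_def using f_nonneg that by (intro sum_mono2) auto
  \<comment> \<open>The coefficient of index \<open>m + N\<close> in \<open>f' = u f\<close>, split at the indices where \<open>u\<close> is at most \<open>-\<delta>\<close>.\<close>
  have step: "\<delta> * S m \<le> u $ 0 * (S (m + N) - S m)" for m
  proof -
    have "0 \<le> fps_deriv f $ (m + N)" using f_nonneg by simp
    also have "\<dots> = (\<Sum>i\<le>m + N. f $ i * u $ (m + N - i))"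
      by (simp add: deriv mult.commute[of u] fps_mult_nth atMost_atLeast0)
    also have "\<dots> = (\<Sum>i\<le>m. f $ i * u $ (m + N - i)) + (\<Sum>i\<in>{m<..m + N}. f $ i * u $ (m + N - i))"
      by (subst sum.union_disjoint[symmetric]) (auto intro!: sum.cong)
    also have "\<dots> \<le> (\<Sum>i\<le>m. f $ i * - \<delta>) + (\<Sum>i\<in>{m<..m + N}. f $ i * u $ 0)"
      by (intro add_mono sum_mono mult_left_mono f_nonneg)
         (auto simp: \<delta>_def intro!: antimonoD[OF anti])
    also have "(\<Sum>i\<in>{m<..m + N}. f $ i * u $ 0) = (S (m + N) - S m) * u $ 0"
    proof -
      have "S (m + N) = S m + (\<Sum>i\<in>{m<..m + N}. f $ i)"
        unfolding S_def by (subst sum.union_disjoint[symmetric]) (auto intro!: sum.cong)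
      then show ?thesis by (simp add: sum_distrib_right)
    qed
    also have "(\<Sum>i\<le>m. f $ i * - \<delta>) = - (\<delta> * S m)"
      by (simp add: S_def sum_distrib_left sum_negf mult.commute)
    finally show ?thesis by (simp add: mult.commute)
  qed
  have u0: "u $ 0 > 0"
  proof (rule ccontr)
    assume "\<not> u $ 0 > 0"
    then have "u $ 0 * (S (0 + N) - S 0) \<le> 0"
      using S_mono[of 0 "0 + N"] by (intro mult_nonpos_nonneg) auto
    moreover have "\<delta> * S 0 > 0" using \<open>\<delta> > 0\<close> S_ge_1[of 0] by (intro mult_pos_pos) auto
    ultimately show False using step[of 0] by linarith
  qed
  then have "N > 0" using \<open>\<not> u $ N \<ge> 0\<close> by (cases N) auto
  define \<rho> where "\<rho> = 1 + \<delta> / u $ 0"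
  have "\<rho> > 1" using u0 \<open>\<delta> > 0\<close> by (simp add: \<rho>_def)
  have "\<rho> * S m \<le> S (m + N)" for m
    using step[of m] u0 by (simp add: \<rho>_def field_simps)
  then have grow: "\<rho> ^ k \<le> S (k * N)" for k
  proof (induction k)
    case 0
    show ?case using S_ge_1 by simp
  next
    case (Suc k)
    have "\<rho> ^ Suc k \<le> \<rho> * S (k * N)" using Suc \<open>\<rho> > 1\<close> by simp
    also have "\<dots> \<le> S (Suc k * N)" using Suc.prems[of "k * N"] by (simp add: add.commute)
    finally show ?case .
  qed
  \<comment> \<open>Any \<open>x < 1\<close> with \<open>\<rho> * x ^ N > 1\<close> would do; this one gives \<open>\<rho> * x ^ N = 2 * \<rho> / (1 + \<rho>)\<close>.\<close>
  define x where "x = root N (2 / (1 + \<rho>))"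
  have x: "0 < x" "x < 1" "x ^ N = 2 / (1 + \<rho>)"
    using \<open>N > 0\<close> \<open>\<rho> > 1\<close> by (simp_all add: x_def)
  define T where "T = (\<Sum>i. f $ i * x ^ i)"
  have bound: "S n * x ^ n \<le> T" for n
  proof -
    have "S n * x ^ n \<le> (\<Sum>i\<le>n. f $ i * x ^ i)"
      unfolding S_def sum_distrib_right using f_nonneg x
      by (intro sum_mono mult_left_mono power_decreasing) auto
    also have "\<dots> \<le> T"
      unfolding T_def using f_nonneg x by (intro sum_le_suminf summ) auto
    finally show ?thesis .
  qed
  define \<sigma> where "\<sigma> = \<rho> * x ^ N"
  have "\<sigma> > 1" using \<open>\<rho> > 1\<close> by (simp add: \<sigma>_def x field_simps)
  have "\<sigma> ^ k \<le> T" for k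
  proof -
    have "\<sigma> ^ k = \<rho> ^ k * x ^ (k * N)"
      by (simp add: \<sigma>_def power_mult_distrib power_mult [symmetric] mult.commute)
    also have "\<dots> \<le> S (k * N) * x ^ (k * N)"
      using grow x by (intro mult_right_mono) auto
    also have "\<dots> \<le> T" by (rule bound)
    finally show ?thesis .
  qed
  moreover obtain k where "T < \<sigma> ^ k" using real_arch_pow[OF \<open>\<sigma> > 1\<close>] by blast
  ultimately show False by (metis not_less)
qed

text \<open>
  With \<open>h = 1 - k\<close> the inverse is the geometric series \<open>1 + k + k\<^sup>2 + \<dots>\<close>, and \<open>k\<close> has nonnegative
  coefficients.
\<close>

lemma inverse_nth_nonneg:
  fixes h :: "real fps"
  assumes "h $ 0 = 1" and "\<And>n. n \<ge> 1 \<Longrightarrow> h $ n \<le> 0"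
  shows "inverse h $ n \<ge> 0"
proof (induction n rule: less_induct)
  case (less n)
  show ?case
  proof (cases n)
    case 0
    then show ?thesis using assms by simp
  next
    case (Suc m)
    have "(h * inverse h) $ n = 0"
      using Suc assms inverse_mult_eq_1'[of h] by simp
    then have "inverse h $ n = (\<Sum>i=1..n. - h $ i * inverse h $ (n - i))"
      by (simp add: fps_mult_nth sum.atLeast_Suc_atMost assms sum_negf)
    also have "\<dots> \<ge> 0"
      using assms(2) less by (intro sum_nonneg mult_nonneg_nonneg) auto
    finally show ?thesis .
  qed
qed

section \<open>Monotonicity and bounds for the coefficients of \<open>F' / F\<close>\<close>

lemma log_deriv_hyp_degenerate:
  assumes "c > 0" and "c = a \<or> c = b"
  shows "log_deriv (hyp a b c) $ n = a + b - c"
proof -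
  have "hyp (c - a) (c - b) c = 1"
    using assms(2) by (auto simp: fps_eq_iff hyp_nth pochhammer_0_left)
  then show ?thesis
    using euler_log_deriv_nth[OF assms(1), of a b n] by (simp add: log_deriv_def)
qed

text \<open>
  Let \<open>g = (1 - x) F' / F\<close>. The Riccati equation gives \<open>g_1\<close> the sign of \<open>- (c - a)(c - b)\<close>. From then on
  \<open>(m + 2 + c) g_(m+2)\<close> is \<open>(m + 1 + a + b - 2 g_0) g_(m+1)\<close> minus the sum of the products
  \<open>g_i g_j\<close> with \<open>i, j \<ge> 1\<close> and \<open>i + j = m + 1\<close>. If the earlier coefficients are negative, these products are positive, and the dominance
  condition yields \<open>2 g_0 = 2ab/c < 1 + a + b\<close>, so the next coefficient is negative too.
\<close>

lemma log_deriv_hyp_strict_decreasing: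
  assumes pos: "a > 0" "b > 0" "c > 0"
    and dominance: "(1 + a + b - a * b) * c \<ge> 2 * a * b"
    and side: "(c - a) * (c - b) > 0"
  shows "log_deriv (hyp a b c) $ Suc n < log_deriv (hyp a b c) $ n"
proof -
  define g where "g = (1 - fps_X) * log_deriv (hyp a b c)"
  have ric: "riccati a b c g" unfolding g_def by (rule riccati_hyp[OF pos(3)])
  have g0: "g $ 0 = a * b / c" using riccati_nth_0[OF ric] pos by (simp add: field_simps)
  have "g $ Suc n < 0" for n
  proof (induction n rule: less_induct)
    case (less n)
    show ?case
    proof (cases n)
      case 0
      have "c\<^sup>2 * ((1 + c) * g $ 1) = - (a * b * ((c - a) * (c - b)))"
      proof -
        have "(1 + c) * g $ 1 = (a + b) * g $ 0 - g $ 0 * g $ 0 - a * b"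
          using riccati_nth_Suc[OF ric, of 0] by simp
        then show ?thesis using riccati_nth_0[OF ric] by algebra
      qed
      also have "\<dots> < 0" using pos side by simp
      finally show ?thesis using 0 pos by (simp add: mult_less_0_iff)
    next
      case (Suc m)
      have "(g * g) $ Suc m = 2 * g $ 0 * g $ Suc m + (\<Sum>i=1..m. g $ i * g $ (Suc m - i))"
        by (simp add: fps_mult_nth sum.atLeast_Suc_atMost[of 0] algebra_simps)
      then have rec: "(real m + 2 + c) * g $ Suc (Suc m) = (real m + 1 + a + b - 2 * g $ 0) * g $ Suc m
          - (\<Sum>i=1..m. g $ i * g $ (Suc m - i))"
        using riccati_nth_Suc[OF ric, of "Suc m"] by (simp add: algebra_simps)
      have "g $ i * g $ (Suc m - i) \<ge> 0" if "i \<in> {1..m}" for i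
        using less[of "i - 1"] less[of "m - i"] that Suc
        by (intro mult_nonpos_nonpos) (auto simp: Suc_diff_le less_imp_le)
      then have "(\<Sum>i=1..m. g $ i * g $ (Suc m - i)) \<ge> 0" by (rule sum_nonneg)
      moreover have "(real m + 1 + a + b - 2 * g $ 0) * g $ Suc m < 0"
      proof (rule mult_pos_neg)
        have "2 * (a * b) < (1 + a + b) * c"
          using dominance mult_pos_pos[OF mult_pos_pos[OF pos(1,2)] pos(3)] by (simp add: algebra_simps)
        then have "2 * g $ 0 < 1 + a + b" using pos by (simp add: g0 field_simps)
        then show "real m + 1 + a + b - 2 * g $ 0 > 0" by linarith
      qed (use less[of m] Suc in simp)
      ultimately have "(real m + 2 + c) * g $ Suc (Suc m) < 0" using rec by linarith
      then show ?thesis using Suc pos by (simp add: mult_less_0_iff)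
    qed
  qed
  then show ?thesis using nth_Suc_eq_add_nth_one_minus_X[of "log_deriv (hyp a b c)" n] by (simp add: g_def)
qed

lemma log_deriv_hyp_decreasing_nonneg:
  assumes "a > -1" "b > -1" "c > 0" "a * b \<ge> 0"
    and anti: "\<And>n. log_deriv (hyp a b c) $ Suc n \<le> log_deriv (hyp a b c) $ n"
  shows "log_deriv (hyp a b c) $ n \<ge> 0"
proof (rule antimono_log_deriv_nonneg)
  show "hyp a b c $ n \<ge> 0" for n
  proof (cases "n = 0")
    case False
    then obtain k where "k > 0" "hyp a b c $ n = a * b * k"
      using hyp_nth_sign[of a b c n] assms by auto
    then show ?thesis using assms by simp
  qed simp
  show "summable (\<lambda>n. hyp a b c $ n * x ^ n)" if "0 < x" "x < 1" for x
    using assms that by (intro summable_hyp) auto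
  show "fps_deriv (hyp a b c) = log_deriv (hyp a b c) * hyp a b c"
    by (simp add: log_deriv_mult)
  show "antimono (($) (log_deriv (hyp a b c)))"
    using anti by (rule decseq_SucI)
qed simp

text \<open>
  The two bounds come from the same argument, for \<open>F(a,b;c;\<cdot>)\<close> and for its Euler transform: the two
  sequences differ by a constant, so they decrease together.
\<close>

lemma log_deriv_hyp_ge:
  assumes pos: "a > 0" "b > 0" "c > 0" and "c \<ge> a + b - 1"
    and dominance: "(1 + a + b - a * b) * c \<ge> 2 * a * b"
    and side: "(c - a) * (c - b) > 0"
  shows "log_deriv (hyp a b c) $ n \<ge> max 0 (a + b - c)"
proof -
  let ?u = "log_deriv (hyp a b c)" and ?v = "log_deriv (hyp (c - a) (c - b) c)"
  have u: "?u $ Suc n \<le> ?u $ n" for n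
    using log_deriv_hyp_strict_decreasing[OF pos dominance side] less_imp_le by blast
  have v: "?v $ Suc n \<le> ?v $ n" for n
    using u[of n] euler_log_deriv_nth[OF pos(3), of a b] by simp
  have "?u $ n \<ge> 0"
    using u pos by (intro log_deriv_hyp_decreasing_nonneg) auto
  moreover have "?v $ n \<ge> 0"
    using v assms by (intro log_deriv_hyp_decreasing_nonneg) auto
  ultimately show ?thesis
    using euler_log_deriv_nth[OF pos(3), of a b n] by simp
qed

lemma hyp_nth_neg:
  assumes "a > -1" "b > -1" "c > 0" "a * b < 0" "n \<ge> 1"
  shows "hyp a b c $ n < 0"
proof -
  obtain k where "k > 0" "hyp a b c $ n = a * b * k"
    using hyp_nth_sign[of a b c n] assms by auto
  then show ?thesis using assms by (simp add: mult_neg_pos)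
qed

text \<open>
  For the Euler transform \<open>h\<close>, the coefficients of \<open>h'\<close> are negative and those of \<open>1/h\<close> are nonnegative, so
  \<open>h' / h\<close> has coefficients of at most \<open>0\<close>.
\<close>

lemma log_deriv_hyp_le:
  assumes pos: "a > 0" "b > 0" "c > 0" and "c \<ge> a + b - 1"
    and side: "(c - a) * (c - b) < 0"
  shows "log_deriv (hyp a b c) $ n \<le> a + b - c"
proof -
  define h where "h = hyp (c - a) (c - b) c"
  have h: "h $ n < 0" if "n \<ge> 1" for n
    unfolding h_def using assms that by (intro hyp_nth_neg) auto
  have "log_deriv h $ n = (\<Sum>i=0..n. fps_deriv h $ i * inverse h $ (n - i))"
    by (simp add: log_deriv_def fps_mult_nth)
  also have "\<dots> \<le> 0"
  proof (intro sum_nonpos mult_nonpos_nonneg)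
    show "fps_deriv h $ i \<le> 0" for i
      using h[of "Suc i"] by (simp add: mult_nonneg_nonpos less_imp_le)
    show "inverse h $ i \<ge> 0" for i
      using h by (intro inverse_nth_nonneg) (auto simp: h_def less_imp_le)
  qed
  finally show ?thesis
    using euler_log_deriv_nth[OF pos(3), of a b n] by (simp add: h_def)
qed

text \<open>
  The recurrence used in the decreasing case gives no sign here, since its products now count against the
  claim. Instead, Euler's transformation writes \<open>g - g_0\<close> as \<open>N / h\<close> with an explicit numerator whose
  coefficients are \<open>- i g_0 h_i / (i + c)\<close>. These are positive for \<open>i \<ge> 1\<close>, and \<open>1/h\<close> has nonnegative
  coefficients and constant term \<open>1\<close>.
\<close>

lemma log_deriv_hyp_strict_increasing:
  assumes pos: "a > 0" "b > 0" "c > 0" and "c \<ge> a + b - 1"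
    and side: "(c - a) * (c - b) < 0"
  shows "log_deriv (hyp a b c) $ n < log_deriv (hyp a b c) $ Suc n"
proof -
  define h where "h = hyp (c - a) (c - b) c"
  define g where "g = (1 - fps_X) * log_deriv (hyp a b c)"
  define s where "s = a + b - c"
  define g0 where "g0 = a * b / c"
  have g_0: "g $ 0 = g0" using pos by (simp add: g_def log_deriv_hyp_0 g0_def)
  have h: "h $ n < 0" if "n \<ge> 1" for n
    unfolding h_def using assms that by (intro hyp_nth_neg) auto
  define N where "N = fps_const (s - g0) * h + (1 - fps_X) * fps_deriv h"
  have "g = (1 - fps_X) * log_deriv h + fps_const s"
    unfolding g_def h_def s_def using pos by (intro euler_log_deriv)
  then have "(g - fps_const g0) * h
      = (1 - fps_X) * (log_deriv h * h) + (fps_const s - fps_const g0) * h"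
    by algebra
  also have "\<dots> = N"
    by (simp add: N_def log_deriv_mult h_def)
  finally have "(g - fps_const g0) * (h * inverse h) = N * inverse h"
    by (simp add: mult.assoc [symmetric])
  moreover have "h * inverse h = 1" by (rule inverse_mult_eq_1') (simp add: h_def)
  ultimately have g_eq: "g - fps_const g0 = N * inverse h" by (simp only: mult_1_right)
  have N_0: "N $ 0 = 0"
    using arg_cong[OF g_eq, of "\<lambda>f. f $ 0"] by (simp add: g_0 h_def)
  have N_pos: "N $ i > 0" if "i \<ge> 1" for i
  proof -
    obtain m where m: "i = Suc m" using \<open>i \<ge> 1\<close> by (cases i) auto
    have c0: "c * g0 = a * b" using pos by (simp add: g0_def)
    have "(real i + c) * N $ i = (real i + c) * (s - g0 - i) * h $ i
        + (real i + 1) * (real i + c) * h $ Suc i"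
      by (simp add: N_def m algebra_simps)
    also have "\<dots> = ((real i + c) * (s - g0 - i) + (real i + (c - a)) * (real i + (c - b))) * h $ i"
      using hyp_nth_Suc[OF pos(3), of i "c - a" "c - b"] by (simp add: h_def algebra_simps)
    also have "(real i + c) * (s - g0 - i) + (real i + (c - a)) * (real i + (c - b)) = - (real i * g0)"
      using c0 by (simp add: s_def algebra_simps)
    also have "- (real i * g0) * h $ i > 0"
    proof (rule mult_neg_neg)
      show "- (real i * g0) < 0" using that pos by (simp add: g0_def)
    qed (rule h[OF that])
    finally show ?thesis using pos by (simp add: zero_less_mult_iff)
  qed
  have "g $ Suc n = (\<Sum>i=0..Suc n. N $ i * inverse h $ (Suc n - i))"
    using arg_cong[OF g_eq, of "\<lambda>f. f $ Suc n"] by (simp add: fps_mult_nth)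
  also have "\<dots> \<ge> N $ Suc n * inverse h $ (Suc n - Suc n)"
  proof (rule member_le_sum)
    fix i assume "i \<in> {0..Suc n} - {Suc n}"
    have "inverse h $ (Suc n - i) \<ge> 0"
      using h by (intro inverse_nth_nonneg) (auto simp: h_def less_imp_le)
    then show "0 \<le> N $ i * inverse h $ (Suc n - i)"
      using N_0 N_pos[of i] by (cases "i = 0") (auto intro!: mult_nonneg_nonneg less_imp_le)
  qed auto
  finally have "g $ Suc n > 0" using N_pos[of "Suc n"] by (simp add: h_def)
  then show ?thesis using nth_Suc_eq_add_nth_one_minus_X[of "log_deriv (hyp a b c)" n] by (simp add: g_def)
qed

section \<open>From the coefficients to the functions\<close>

lemma conv_radius_bounded:
  fixes f :: "real fps"
  assumes "\<And>n. \<bar>f $ n\<bar> \<le> M"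
  shows "fps_conv_radius f \<ge> 1"
  unfolding fps_conv_radius_def one_ereal_def
proof (rule conv_radius_geI_ex')
  fix r :: real assume r: "0 < r" "ereal r < ereal 1"
  show "summable (\<lambda>n. f $ n * of_real r ^ n)"
  proof (rule summable_comparison_test')
    show "summable (\<lambda>n. M * r ^ n)" using r by (intro summable_mult summable_geometric) auto
    show "norm (f $ n * of_real r ^ n) \<le> M * r ^ n" for n
      using assms r by (simp add: abs_mult mult_right_mono)
  qed
qed

text \<open>
  Differentiating \<open>n\<close> times near \<open>0\<close> only uses the germ of \<open>f\<close>, which is that of the power series.
\<close>

lemma maclaurin_coeff_power_series:
  fixes w :: "real fps"
  assumes "fps_conv_radius w > 0" and "\<forall>\<^sub>F x in nhds 0. f x = eval_fps w x"
  shows "maclaurin_coeff f n = w $ n"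
proof -
  have "(deriv ^^ n) (eval_fps w) 0 / fact n = w $ n"
    using assms(1)
  proof (induction n arbitrary: w)
    case 0
    then show ?case by (simp add: eval_fps_at_0)
  next
    case (Suc n)
    have "\<forall>\<^sub>F z in nhds 0. z \<in> eball 0 (fps_conv_radius w)"
      using Suc.prems by (intro eventually_nhds_in_open) (auto simp: zero_ereal_def)
    then have "\<forall>\<^sub>F z in nhds 0. deriv (eval_fps w) z = eval_fps (fps_deriv w) z"
      by eventually_elim (simp add: eval_fps_deriv)
    then have "(deriv ^^ Suc n) (eval_fps w) 0 = (deriv ^^ n) (eval_fps (fps_deriv w)) 0"
      unfolding funpow_Suc_right o_def by (intro higher_deriv_cong_ev refl)
    also have "\<dots> / fact n = fps_deriv w $ n"
      using Suc.prems fps_conv_radius_deriv[of w] by (intro Suc.IH) auto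
    then have "(deriv ^^ n) (eval_fps (fps_deriv w)) 0 = fact n * fps_deriv w $ n"
      by (simp add: field_simps)
    also have "fact n * fps_deriv w $ n = fact (Suc n) * w $ Suc n" by (simp add: algebra_simps)
    finally show ?case by (simp del: fact_Suc funpow.simps)
  qed
  moreover have "(deriv ^^ n) f 0 = (deriv ^^ n) (eval_fps w) 0"
    using assms(2) by (intro higher_deriv_cong_ev refl)
  ultimately show ?thesis by (simp add: maclaurin_coeff_def)
qed

text \<open>
  If \<open>u = f' / f\<close> and \<open>f 0 = 1\<close>, this is the Maclaurin series of \<open>ln ((1 - x) powr s * f x)\<close>: its derivative is
  \<open>u\<close> minus the geometric series \<open>s / (1 - x)\<close>.
\<close>

definition ln_series :: "real \<Rightarrow> real fps \<Rightarrow> real fps" where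
  "ln_series s u = fps_integral0 (u - Abs_fps (\<lambda>_. s))"

lemma ln_series_nth: "j \<ge> 1 \<Longrightarrow> ln_series s u $ j = (u $ (j - 1) - s) / j"
  by (cases j) (simp_all add: ln_series_def field_simps)

lemma ln_series_conv_radius:
  assumes "\<And>n. \<bar>u $ n\<bar> \<le> M"
  shows "fps_conv_radius (ln_series s u) \<ge> 1"
proof (rule conv_radius_bounded)
  have "M \<ge> 0" using assms[of 0] by linarith
  fix n show "\<bar>ln_series s u $ n\<bar> \<le> M + \<bar>s\<bar>"
  proof (cases n)
    case (Suc m)
    have "\<bar>u $ m - s\<bar> \<le> M + \<bar>s\<bar>" using assms[of m] by linarith
    also have "\<dots> \<le> (M + \<bar>s\<bar>) * (1 + real m)" using \<open>M \<ge> 0\<close> by (simp add: algebra_simps)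
    finally show ?thesis using Suc by (simp add: ln_series_nth divide_simps)
  qed (use \<open>M \<ge> 0\<close> in \<open>simp add: ln_series_def\<close>)
qed

text \<open>
  Both sides have the value \<open>1\<close> at \<open>0\<close> and the same logarithmic derivative, so their quotient is constant. In
  particular \<open>f\<close> is positive on the whole interval, which makes its logarithm meaningful there.
\<close>

lemma weighted_power_series_eq_exp:
  fixes f u :: "real fps"
  assumes f0: "f $ 0 = 1" and rad: "fps_conv_radius f \<ge> 1"
    and deriv: "fps_deriv f = u * f" and bounded: "\<And>n. \<bar>u $ n\<bar> \<le> M"
    and x: "\<bar>x\<bar> < 1"
  shows "(1 - x) powr s * eval_fps f x = exp (eval_fps (ln_series s u) x)"
proof -
  let ?W = "ln_series s u"
  define \<phi> where "\<phi> x = (1 - x) powr s * eval_fps f x * exp (- eval_fps ?W x)" for x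
  have radW: "fps_conv_radius ?W \<ge> 1" by (rule ln_series_conv_radius[OF bounded])
  have radu: "fps_conv_radius u \<ge> 1" by (rule conv_radius_bounded[OF bounded])
  have rads: "fps_conv_radius (Abs_fps (\<lambda>_. s)) \<ge> 1" by (rule conv_radius_bounded[of _ "\<bar>s\<bar>"]) simp
  have "\<exists>k. \<forall>y\<in>{-1<..<1}. \<phi> y = k"
  proof (rule has_field_derivative_zero_constant)
    fix y :: real assume "y \<in> {-1<..<1}"
    then have y: "\<bar>y\<bar> < 1" by auto
    then have in_disc: "ereal (norm y) < fps_conv_radius h" if "fps_conv_radius h \<ge> 1" for h :: "real fps"
      using less_le_trans[OF _ that, of "ereal (norm y)"] by (simp add: one_ereal_def)
    have f': "eval_fps (fps_deriv f) y = eval_fps u y * eval_fps f y"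
      unfolding deriv by (intro eval_fps_mult in_disc rad radu)
    have "eval_fps (Abs_fps (\<lambda>_. s)) y = s / (1 - y)"
      using y suminf_mult[OF summable_geometric, of y s] suminf_geometric[of y] by (simp add: eval_fps_def)
    then have W': "eval_fps (fps_deriv ?W) y = eval_fps u y - s / (1 - y)"
      unfolding ln_series_def fps_deriv_fps_integral
      by (subst eval_fps_diff) (use in_disc radu rads in auto)
    have dpow: "((\<lambda>x. (1 - x) powr s) has_real_derivative - (s * (1 - y) powr (s - 1))) (at y within {-1<..<1})"
      using y by (auto intro!: derivative_eq_intros)
    have pow: "(1 - y) powr (s - 1) = (1 - y) powr s / (1 - y)"
      using y by (simp add: powr_diff)
    have "(\<phi> has_real_derivative
        (- (s * (1 - y) powr (s - 1)) * eval_fps f y + (1 - y) powr s * eval_fps (fps_deriv f) y)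
          * exp (- eval_fps ?W y)
        + (1 - y) powr s * eval_fps f y * (exp (- eval_fps ?W y) * - eval_fps (fps_deriv ?W) y))
        (at y within {-1<..<1})"
      unfolding \<phi>_def
      by (rule derivative_eq_intros dpow has_field_derivative_eval_fps in_disc rad radW refl | simp)+
    then show "(\<phi> has_real_derivative 0) (at y within {-1<..<1})"
      by (rule DERIV_cong) (simp add: f' W' pow algebra_simps)
  qed simp
  then obtain k where k: "\<And>y. y \<in> {-1<..<1} \<Longrightarrow> \<phi> y = k" by blast
  have "x \<in> {-1<..<1}" using x by auto
  then have "\<phi> x = \<phi> 0" using k[of x] k[of 0] by simp
  also have "\<phi> 0 = 1" by (simp add: \<phi>_def eval_fps_at_0 f0 ln_series_def)
  finally show ?thesis by (simp add: \<phi>_def exp_minus field_simps)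
qed

lemma gauss_hypergeo_eval: "gauss_hypergeo a b c x = eval_fps (hyp a b c) x"
  by (simp add: gauss_hypergeo_def eval_fps_def hyp_nth field_simps)

lemma hyp_F_eq_exp:
  assumes "c > 0" "\<And>n. \<bar>log_deriv (hyp a b c) $ n\<bar> \<le> M" "\<bar>x\<bar> < 1"
  shows "hyp_F a b c s x = exp (eval_fps (ln_series s (log_deriv (hyp a b c))) x)"
  unfolding hyp_F_def gauss_hypergeo_eval
  using assms by (intro weighted_power_series_eq_exp) (auto simp: log_deriv_mult conv_radius_hyp)

lemma w_coeff_eq:
  assumes "c > 0" "\<And>n. \<bar>log_deriv (hyp a b c) $ n\<bar> \<le> M"
  shows "w_coeff a b c s n = ln_series s (log_deriv (hyp a b c)) $ n"
  unfolding w_coeff_def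
proof (rule maclaurin_coeff_power_series)
  show "fps_conv_radius (ln_series s (log_deriv (hyp a b c))) > 0"
    using less_le_trans[OF _ ln_series_conv_radius[OF assms(2)], of 0] by simp
  have "\<forall>\<^sub>F x in nhds 0. x \<in> {-1<..<(1::real)}" by (intro eventually_nhds_in_open) auto
  then show "\<forall>\<^sub>F x in nhds 0. ln (hyp_F a b c s x) = eval_fps (ln_series s (log_deriv (hyp a b c))) x"
    by eventually_elim (subst hyp_F_eq_exp[OF assms], auto)
qed

lemma C_coeff_eq:
  assumes "c > 0" "\<And>n. \<bar>log_deriv (hyp a b c) $ n\<bar> \<le> M" "k \<ge> 1"
  shows "real k * C_coeff a b c k = log_deriv (hyp a b c) $ (k - 1)"
proof -
  have "C_coeff a b c k = w_coeff a b c 0 k"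
    unfolding C_coeff_def w_coeff_def maclaurin_coeff_def
  proof (intro arg_cong2[where f = "(/)"] higher_deriv_cong_ev refl)
    have "\<forall>\<^sub>F x in nhds 0. x \<in> {-1<..<(1::real)}" by (intro eventually_nhds_in_open) auto
    then show "\<forall>\<^sub>F x in nhds 0. ln (gauss_hypergeo a b c x) = ln (hyp_F a b c 0 x)"
      by eventually_elim (simp add: hyp_F_def)
  qed
  then show ?thesis using assms(3) by (simp add: w_coeff_eq[OF assms(1,2)] ln_series_nth)
qed

lemma eval_fps_gt_partial_sum:
  fixes f :: "real fps"
  assumes "fps_conv_radius f \<ge> 1" "0 < x" "x < 1" and pos: "\<And>j. j > n \<Longrightarrow> f $ j > 0"
  shows "(\<Sum>j\<le>n. f $ j * x ^ j) < eval_fps f x"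
proof -
  have "ereal (norm x) < fps_conv_radius f"
    using assms less_le_trans[OF _ assms(1), of "ereal (norm x)"] by (simp add: one_ereal_def)
  then have summ: "summable (\<lambda>j. f $ j * x ^ j)" by (rule summable_fps)
  have "0 < (\<Sum>j. f $ (j + Suc n) * x ^ (j + Suc n))"
    using \<open>0 < x\<close>
    by (intro suminf_pos pos mult_pos_pos summable_ignore_initial_segment[OF summ] zero_less_power) auto
  then show ?thesis
    using suminf_split_initial_segment[OF summ, of "Suc n"] by (simp add: eval_fps_def lessThan_Suc_atMost)
qed

text \<open>
  After division by \<open>(1 - x) powr (-s)\<close> both functions are exponentials, of the full series and of its partial
  sum. The remaining tail has the coefficients \<open>(u_(j-1) - s) / j\<close> with \<open>j > n\<close>.
\<close>

lemma exp_bound_tail_sign: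
  assumes "c > 0" and bounded: "\<And>n. \<bar>log_deriv (hyp a b c) $ n\<bar> \<le> M" and x: "0 < x" "x < 1"
  shows exp_bound_less: "(\<And>j. j \<ge> n \<Longrightarrow> s < log_deriv (hyp a b c) $ j) \<Longrightarrow>
      exp_bound a b c s n x < gauss_hypergeo a b c x"
    and less_exp_bound: "(\<And>j. j \<ge> n \<Longrightarrow> log_deriv (hyp a b c) $ j < s) \<Longrightarrow>
      gauss_hypergeo a b c x < exp_bound a b c s n x"
proof -
  define W where "W = ln_series s (log_deriv (hyp a b c))"
  have W_nth: "W $ j = (log_deriv (hyp a b c) $ (j - 1) - s) / j" if "j \<ge> 1" for j
    using that by (simp add: W_def ln_series_nth)
  have rad: "fps_conv_radius W \<ge> 1" unfolding W_def by (rule ln_series_conv_radius[OF bounded])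
  have sum: "(\<Sum>j=1..n. w_coeff a b c s j * x ^ j) = (\<Sum>j\<le>n. W $ j * x ^ j)"
  proof -
    have "(\<Sum>j\<le>n. W $ j * x ^ j) = (\<Sum>j=1..n. W $ j * x ^ j)"
      by (simp add: atMost_atLeast0 sum.atLeast_Suc_atMost[of 0] W_def ln_series_def)
    then show ?thesis using assms by (simp add: w_coeff_eq[OF assms(1,2)] W_def)
  qed
  have pow: "(1 - x) powr s > 0" using x by simp
  have F: "gauss_hypergeo a b c x = exp (eval_fps W x) / (1 - x) powr s"
    using hyp_F_eq_exp[OF assms(1,2), of x s] x pow by (simp add: hyp_F_def W_def field_simps)
  show "exp_bound a b c s n x < gauss_hypergeo a b c x" if "\<And>j. j \<ge> n \<Longrightarrow> s < log_deriv (hyp a b c) $ j"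
  proof -
    have "(\<Sum>j\<le>n. W $ j * x ^ j) < eval_fps W x"
      using that by (intro eval_fps_gt_partial_sum rad x) (simp add: W_nth)
    then show ?thesis unfolding exp_bound_def sum F using pow by (intro divide_strict_right_mono) auto
  qed
  show "gauss_hypergeo a b c x < exp_bound a b c s n x" if "\<And>j. j \<ge> n \<Longrightarrow> log_deriv (hyp a b c) $ j < s"
  proof -
    have "(\<Sum>j\<le>n. (- W) $ j * x ^ j) < eval_fps (- W) x"
      using that rad by (intro eval_fps_gt_partial_sum x) (simp_all add: W_nth divide_neg_pos)
    moreover have "eval_fps (- W) x = - eval_fps W x"
    proof -
      have "ereal (norm x) < fps_conv_radius W"
        using x less_le_trans[OF _ rad, of "ereal (norm x)"] by (simp add: one_ereal_def)
      then show ?thesis by (simp add: eval_fps_def suminf_minus[OF summable_fps])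
    qed
    ultimately have "eval_fps W x < (\<Sum>j\<le>n. W $ j * x ^ j)" by (simp add: sum_negf)
    then show ?thesis unfolding exp_bound_def sum F using pow by (intro divide_strict_right_mono) auto
  qed
qed

section \<open>The double inequality\<close>

lemma double_ineqI:
  assumes "c > 0" and "\<And>j. \<bar>log_deriv (hyp a b c) $ j\<bar> \<le> M" and "x \<in> {0<..<1}"
    and "\<And>j. j \<ge> n \<Longrightarrow> p < log_deriv (hyp a b c) $ j \<and> log_deriv (hyp a b c) $ j < q"
  shows "double_ineq a b c p q n x"
  unfolding double_ineq_def
  using exp_bound_less[OF assms(1,2)] less_exp_bound[OF assms(1,2)] assms(3,4) by auto

text \<open>
  Strict monotonicity turns the weak bounds on the coefficients into strict ones: \<open>p \<le> u_(j+1) < u_j\<close>, and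
  \<open>u_j < u_(k-1) \<le> q\<close> because \<open>j \<ge> n \<ge> k\<close>.
\<close>

lemma double_ineq_decreasing:
  assumes "c > 0" and anti: "\<And>j. log_deriv (hyp a b c) $ Suc j < log_deriv (hyp a b c) $ j"
    and lower: "\<And>j. p \<le> log_deriv (hyp a b c) $ j"
    and q: "log_deriv (hyp a b c) $ (k - 1) \<le> q"
    and "1 \<le> k" "k \<le> n" "x \<in> {0<..<1}"
  shows "double_ineq a b c p q n x"
proof (rule double_ineqI[OF \<open>c > 0\<close>])
  let ?u = "log_deriv (hyp a b c)"
  have less: "?u $ j < ?u $ i" if "i < j" for i j
    using that by (rule lift_Suc_mono_less[of "\<lambda>i. - (?u $ i)", simplified, rotated]) (rule anti)
  show "\<bar>?u $ j\<bar> \<le> \<bar>p\<bar> + \<bar>?u $ 0\<bar>" for j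
    using lower[of j] less[of 0 j] by (cases "j = 0") auto
  show "p < ?u $ j \<and> ?u $ j < q" if "j \<ge> n" for j
  proof -
    have "k - 1 < j" using that assms by linarith
    then show ?thesis using lower[of "Suc j"] anti[of j] less[OF \<open>k - 1 < j\<close>] q by simp
  qed
qed fact

lemma double_ineq_increasing:
  assumes "c > 0" and incr: "\<And>j. log_deriv (hyp a b c) $ j < log_deriv (hyp a b c) $ Suc j"
    and upper: "\<And>j. log_deriv (hyp a b c) $ j \<le> q"
    and p: "p \<le> log_deriv (hyp a b c) $ (k - 1)"
    and "1 \<le> k" "k \<le> n" "x \<in> {0<..<1}"
  shows "double_ineq a b c p q n x"
proof (rule double_ineqI[OF \<open>c > 0\<close>])
  let ?u = "log_deriv (hyp a b c)"
  have less: "?u $ i < ?u $ j" if "i < j" for i j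
    using that by (rule lift_Suc_mono_less[of "\<lambda>i. ?u $ i", rotated]) (rule incr)
  show "\<bar>?u $ j\<bar> \<le> \<bar>q\<bar> + \<bar>?u $ 0\<bar>" for j
    using upper[of j] less[of 0 j] by (cases "j = 0") auto
  show "p < ?u $ j \<and> ?u $ j < q" if "j \<ge> n" for j
  proof -
    have "k - 1 < j" using that assms by linarith
    then show ?thesis using upper[of "Suc j"] incr[of j] less[OF \<open>k - 1 < j\<close>] p by simp
  qed
qed fact

text \<open>
  Boundedness is what gives the logarithmic derivative radius of convergence at least \<open>1\<close>. It is needed separately
  from the double inequality, since only then is the coefficient \<open>C_k\<close> in the hypothesis on \<open>q\<close> known to be
  \<open>u_(k-1) / k\<close>.
\<close>

lemma log_deriv_hyp_bounded_region1:
  assumes "(a, b, c) \<in> region1"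
  obtains M where "\<And>j. \<bar>log_deriv (hyp a b c) $ j\<bar> \<le> M"
proof -
  let ?u = "log_deriv (hyp a b c)"
  from assms have r: "a > 0" "b > 0" "c > 0" "c \<ge> a + b - 1" "(1 + a + b - a * b) * c \<ge> 2 * a * b"
    "(c - a) * (c - b) \<ge> 0" by (auto simp: region1_def)
  show ?thesis
  proof (cases "(c - a) * (c - b) = 0")
    case True
    then show ?thesis using log_deriv_hyp_degenerate[OF r(3)] that[of "\<bar>a + b - c\<bar>"] by auto
  next
    case False
    then have side: "(c - a) * (c - b) > 0" using r(6) by linarith
    have "?u $ j \<le> ?u $ 0" for j
      by (rule lift_Suc_antimono_le[of "fps_nth ?u"])
         (auto intro: less_imp_le log_deriv_hyp_strict_decreasing[OF r(1-3) r(5) side])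
    moreover have "?u $ j \<ge> 0" for j using log_deriv_hyp_ge[OF r(1-5) side, of j] by simp
    ultimately show ?thesis using that[of "?u $ 0"] by simp
  qed
qed

lemma log_deriv_hyp_bounded_region2:
  assumes "(a, b, c) \<in> region2"
  obtains M where "\<And>j. \<bar>log_deriv (hyp a b c) $ j\<bar> \<le> M"
proof -
  let ?u = "log_deriv (hyp a b c)"
  from assms have r: "a > 0" "b > 0" "c > 0" "c \<ge> a + b - 1"
    "(c - a) * (c - b) \<le> 0" by (auto simp: region2_def)
  show ?thesis
  proof (cases "(c - a) * (c - b) = 0")
    case True
    then show ?thesis using log_deriv_hyp_degenerate[OF r(3)] that[of "\<bar>a + b - c\<bar>"] by auto
  next
    case False
    then have side: "(c - a) * (c - b) < 0" using r(5) by linarith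
    have "?u $ 0 \<le> ?u $ j" for j
      by (rule lift_Suc_mono_le[of "fps_nth ?u"])
         (auto intro: less_imp_le log_deriv_hyp_strict_increasing[OF r(1-4) side])
    moreover have "?u $ j \<le> a + b - c" for j by (rule log_deriv_hyp_le[OF r(1-4) side])
    ultimately have "\<bar>?u $ j\<bar> \<le> \<bar>?u $ 0\<bar> + \<bar>a + b - c\<bar>" for j
      by (smt (verit))
    then show ?thesis by (rule that)
  qed
qed

lemma double_ineq_degenerate:
  assumes "c > 0" and deg: "c = a \<or> c = b" and "p < a * b / c" "a * b / c < q" and "x \<in> {0<..<1}"
  shows "double_ineq a b c p q n x"
proof (rule double_ineqI[OF \<open>c > 0\<close>])
  have "log_deriv (hyp a b c) $ j = a * b / c" for j
    using log_deriv_hyp_degenerate[OF assms(1,2)] log_deriv_hyp_0[OF assms(1), of a b] by metis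
  then show "\<bar>log_deriv (hyp a b c) $ j\<bar> \<le> \<bar>a * b / c\<bar>"
    and "p < log_deriv (hyp a b c) $ j \<and> log_deriv (hyp a b c) $ j < q" for j
    using assms(3,4) by simp_all
qed fact

lemma double_ineq_region1:
  assumes region: "(a, b, c) \<in> region1"
    and nondegenerate: "c = a \<or> c = b \<Longrightarrow> p \<noteq> a * b / c \<and> q \<noteq> a * b / c"
    and "p \<le> max 0 (a + b - c)" and q: "real k * C_coeff a b c k \<le> q"
    and k: "1 \<le> k" "k \<le> n" and x: "x \<in> {0<..<1}"
  shows "double_ineq a b c p q n x"
proof -
  let ?u = "log_deriv (hyp a b c)"
  from region have r: "a > 0" "b > 0" "c > 0" "c \<ge> a + b - 1" "(1 + a + b - a * b) * c \<ge> 2 * a * b"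
    "(c - a) * (c - b) \<ge> 0" by (auto simp: region1_def)
  obtain M where M: "\<And>j. \<bar>?u $ j\<bar> \<le> M" using log_deriv_hyp_bounded_region1[OF region] by blast
  then have q': "?u $ (k - 1) \<le> q" using q C_coeff_eq[OF r(3) M] k by simp
  show ?thesis
  proof (cases "(c - a) * (c - b) = 0")
    case True
    then have deg: "c = a \<or> c = b" by auto
    have "a * b / c = a + b - c" "a + b - c > 0" using deg r by auto
    then have "p \<le> a * b / c" "a * b / c \<le> q"
      using assms(3) q' log_deriv_hyp_degenerate[OF r(3) deg] by auto
    then show ?thesis using nondegenerate[OF deg] by (intro double_ineq_degenerate r deg x) auto
  next
    case False
    then have side: "(c - a) * (c - b) > 0" using r(6) by linarith
    show ?thesis
    proof (rule double_ineq_decreasing[OF r(3) _ _ q' k x])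
      show "?u $ Suc j < ?u $ j" for j by (rule log_deriv_hyp_strict_decreasing[OF r(1-3) r(5) side])
      show "p \<le> ?u $ j" for j using log_deriv_hyp_ge[OF r(1-5) side, of j] assms(3) by linarith
    qed
  qed
qed

lemma double_ineq_region2:
  assumes region: "(a, b, c) \<in> region2"
    and nondegenerate: "c = a \<or> c = b \<Longrightarrow> p \<noteq> a * b / c \<and> q \<noteq> a * b / c"
    and p: "p \<le> real k * C_coeff a b c k" and "a + b - c \<le> q"
    and k: "1 \<le> k" "k \<le> n" and x: "x \<in> {0<..<1}"
  shows "double_ineq a b c p q n x"
proof -
  let ?u = "log_deriv (hyp a b c)"
  from region have r: "a > 0" "b > 0" "c > 0" "c \<ge> a + b - 1"
    "(c - a) * (c - b) \<le> 0" by (auto simp: region2_def)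
  obtain M where M: "\<And>j. \<bar>?u $ j\<bar> \<le> M" using log_deriv_hyp_bounded_region2[OF region] by blast
  then have p': "p \<le> ?u $ (k - 1)" using p C_coeff_eq[OF r(3) M] k by simp
  show ?thesis
  proof (cases "(c - a) * (c - b) = 0")
    case True
    then have deg: "c = a \<or> c = b" by auto
    have "a * b / c = a + b - c" using deg r by auto
    then have "p \<le> a * b / c" "a * b / c \<le> q"
      using assms(4) p' log_deriv_hyp_degenerate[OF r(3) deg] by auto
    then show ?thesis using nondegenerate[OF deg] by (intro double_ineq_degenerate r deg x) auto
  next
    case False
    then have side: "(c - a) * (c - b) < 0" using r(5) by linarith
    show ?thesis
    proof (rule double_ineq_increasing[OF r(3) _ _ p' k x])
      show "?u $ j < ?u $ Suc j" for j by (rule log_deriv_hyp_strict_increasing[OF r(1-4) side])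
      show "?u $ j \<le> q" for j using log_deriv_hyp_le[OF r(1-4) side, of j] assms(4) by linarith
    qed
  qed
qed

text \<open>
  The bound \<open>ab/c\<close> is the case \<open>k = 1\<close> of the bound \<open>k C_k\<close>, so the first assertion for each region is an
  instance of the second.
\<close>

lemma C_coeff_1:
  assumes "(a, b, c) \<in> region1 \<or> (a, b, c) \<in> region2"
  shows "real 1 * C_coeff a b c 1 = a * b / c"
proof -
  have c: "c > 0" using assms by (auto simp: region1_def region2_def)
  obtain M where "\<And>j. \<bar>log_deriv (hyp a b c) $ j\<bar> \<le> M"
    using assms log_deriv_hyp_bounded_region1 log_deriv_hyp_bounded_region2 by metis
  from C_coeff_eq[OF c this, of 1] show ?thesis using log_deriv_hyp_0[OF c] by simp
qed

(* If c = a or c = b, then F(a,b;c;x) = (1 - x) powr (-s) with s = a * b / c, so all w_j(s)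
   vanish and the side of the double inequality with exponent s is an equality, not strict.
   The hypothesis below excludes exactly these cases; it is vacuous when c differs from a, b. *)
theorem proposition5:
  fixes a b c p q :: real
  assumes nondegenerate: "c = a \<or> c = b \<Longrightarrow> p \<noteq> a * b / c \<and> q \<noteq> a * b / c"
  shows
    "((a, b, c) \<in> region1 \<longrightarrow>
        (p \<le> max 0 (a + b - c) \<and> q \<ge> a * b / c \<longrightarrow>
           (\<forall>x\<in>{0<..<1}. \<forall>n\<ge>1. double_ineq a b c p q n x)) \<and>
        (\<forall>k\<ge>1. p \<le> max 0 (a + b - c) \<and> q \<ge> real k * C_coeff a b c k \<longrightarrow>
           (\<forall>x\<in>{0<..<1}. \<forall>n\<ge>k. double_ineq a b c p q n x))) \<and>
     ((a, b, c) \<in> region2 \<longrightarrow>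
        (p \<le> a * b / c \<and> q \<ge> a + b - c \<longrightarrow>
           (\<forall>x\<in>{0<..<1}. \<forall>n\<ge>1. double_ineq a b c p q n x)) \<and>
        (\<forall>k\<ge>1. p \<le> real k * C_coeff a b c k \<and> q \<ge> a + b - c \<longrightarrow>
           (\<forall>x\<in>{0<..<1}. \<forall>n\<ge>k. double_ineq a b c p q n x)))"
proof (intro conjI impI allI ballI; (elim conjE)?)
  fix x :: real and n :: nat
  assume region: "(a, b, c) \<in> region1" and p: "p \<le> max 0 (a + b - c)" and x: "x \<in> {0<..<1}"
  show "double_ineq a b c p q n x" if "q \<ge> a * b / c" "1 \<le> n"
    using double_ineq_region1[OF region nondegenerate p _ order.refl, of n x] that C_coeff_1[of a b c] region x
    by simp
  show "double_ineq a b c p q n x" if "1 \<le> k" "q \<ge> real k * C_coeff a b c k" "k \<le> n" for k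
    using double_ineq_region1[OF region nondegenerate p that(2,1,3) x] .
next
  fix x :: real and n :: nat
  assume region: "(a, b, c) \<in> region2" and q: "q \<ge> a + b - c" and x: "x \<in> {0<..<1}"
  show "double_ineq a b c p q n x" if "p \<le> a * b / c" "1 \<le> n"
    using double_ineq_region2[OF region nondegenerate _ q order.refl, of n x] that C_coeff_1[of a b c] region x
    by simp
  show "double_ineq a b c p q n x" if "1 \<le> k" "p \<le> real k * C_coeff a b c k" "k \<le> n" for k
    using double_ineq_region2[OF region nondegenerate that(2) q that(1,3) x] .
qed

end
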